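(* On the set of the $512$ mesh patterns $(21,R)$, $R\subseteq\{0,1,2\}\times\{0,1,2\}$, the equivalence relation of coincidence under $231$ (that is, $p_1\sim p_2$ if and only if $\mathrm{Av}(\{231,p_1\})=\mathrm{Av}(\{231,p_2\})$) has exactly $39$ equivalence classes.
   Context: Write $[n]=\{1,\dots,n\}$. A permutation of length $n$ is a bijection of $[n]$, written in one-line notation; $G(\pi)=\{(i,\pi(i)) : i\in[n]\}$ is its plot. A mesh pattern of length $k$ is a pair $p=(\tau,R)$ with $\tau$ a permutation of length $k$ and $R\subseteq\{0,\dots,k\}^2$. An occurrence of $p$ in a permutation $\pi$ of length $n$ is a subset $\omega\subseteq G(\pi)$ for which there are order-preserving injections $\alpha,\beta:[k]\to[n]$ such that (i) $\omega=\{(\alpha(i),\beta(j)):(i,j)\in G(\tau)\}$, and (ii) with $\alpha(0)=\beta(0)=0$, $\alpha(k+1)=\beta(k+1)=n+1$ and $R_{ij}=[\alpha(i)+1,\alpha(i+1)-1]\times[\beta(j)+1,\beta(j+1)-1]$, one has $R_{ij}\cap G(\pi)=\emptyset$ for every $(i,j)\in R$. A permutation avoids $p$ if it has no occurrence of $p$. A classical pattern $\pi$ is identified with the mesh pattern $(\pi,\emptyset)$. $\mathrm{Av}(S)$ is the set of all permutations (of all lengths, including the empty one) avoiding every pattern in $S$. *)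

theory Defs
  imports "HOL-Combinatorics.Multiset_Permutations"
begin

text \<open>
  Permutations of length \<open>n\<close> are lists in one-line notation (a list \<open>xs\<close> with
  \<open>xs ! (i - 1)\<close> the value at \<open>i\<close>).
\<close>

definition perms :: "nat list set" where
  "perms = {xs. xs \<in> permutations_of_set {1..length xs}}"

definition plot :: "nat list \<Rightarrow> (nat \<times> nat) set" where
  "plot xs = {(i, xs ! (i - 1)) |i. i \<in> {1..length xs}}"

type_synonym mesh_pattern = "nat list \<times> (nat \<times> nat) set"

definition mesh_patterns :: "mesh_pattern set" where
  "mesh_patterns =
     {(\<tau>, R). \<tau> \<in> perms \<and> R \<subseteq> {0..length \<tau>} \<times> {0..length \<tau>}}"

definition mesh_box :: "(nat \<Rightarrow> nat) \<Rightarrow> (nat \<Rightarrow> nat) \<Rightarrow> nat \<Rightarrow> nat \<Rightarrow> (nat \<times> nat) set" where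
  "mesh_box \<alpha> \<beta> i j = {\<alpha> i + 1..\<alpha> (i + 1) - 1} \<times> {\<beta> j + 1..\<beta> (j + 1) - 1}"

text \<open>
  An order-preserving injection \<open>[k] \<rightarrow> [n]\<close>, extended by \<open>0 \<mapsto> 0\<close> and \<open>k + 1 \<mapsto> n + 1\<close>.
  (With this, the truncating subtractions in \<open>mesh_box\<close> are never applied to 0 when \<open>i, j \<le> k\<close>.)
\<close>

definition extended_embedding :: "nat \<Rightarrow> nat \<Rightarrow> (nat \<Rightarrow> nat) \<Rightarrow> bool" where
  "extended_embedding k n \<alpha> \<longleftrightarrow>
     strict_mono_on {1..k} \<alpha> \<and> \<alpha> ` {1..k} \<subseteq> {1..n} \<and> \<alpha> 0 = 0 \<and> \<alpha> (k + 1) = n + 1"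

definition occurrence :: "mesh_pattern \<Rightarrow> nat list \<Rightarrow> (nat \<times> nat) set \<Rightarrow> bool" where
  "occurrence p \<pi> \<omega> \<longleftrightarrow>
     (case p of (\<tau>, R) \<Rightarrow>
        \<omega> \<subseteq> plot \<pi> \<and>
        (\<exists>\<alpha> \<beta>. extended_embedding (length \<tau>) (length \<pi>) \<alpha> \<and>
               extended_embedding (length \<tau>) (length \<pi>) \<beta> \<and>
               \<omega> = {(\<alpha> i, \<beta> j) |i j. (i, j) \<in> plot \<tau>} \<and>
               (\<forall>(i, j)\<in>R. mesh_box \<alpha> \<beta> i j \<inter> plot \<pi> = {})))"

definition avoids :: "nat list \<Rightarrow> mesh_pattern \<Rightarrow> bool" where
  "avoids \<pi> p \<longleftrightarrow> (\<nexists>\<omega>. occurrence p \<pi> \<omega>)"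

definition Av :: "mesh_pattern set \<Rightarrow> nat list set" where
  "Av S = {\<pi> \<in> perms. \<forall>p\<in>S. avoids \<pi> p}"

definition classical :: "nat list \<Rightarrow> mesh_pattern" where
  "classical \<pi> = (\<pi>, {})"

definition mesh_patterns_of :: "nat list \<Rightarrow> mesh_pattern set" where
  "mesh_patterns_of \<tau> = {p \<in> mesh_patterns. fst p = \<tau>}"

definition coincidence_under :: "nat list \<Rightarrow> mesh_pattern set \<Rightarrow> mesh_pattern rel" where
  "coincidence_under \<sigma> P =
     {(p\<^sub>1, p\<^sub>2). p\<^sub>1 \<in> P \<and> p\<^sub>2 \<in> P \<and> Av {classical \<sigma>, p\<^sub>1} = Av {classical \<sigma>, p\<^sub>2}}"

end

(*
  In a 231-avoider the boxes (0,1) and (1,2) of every inversion are empty. If some further box c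
  of an inversion is occupied, replacing one of its two points by an extremal point of c gives an
  inversion for which c is empty, and the other boxes can only gain points in a controlled way.
  So for suitable R shading c changes nothing. Unshading boxes by these rules, together with two
  squeezing arguments (shading is monotone), reduces the 512 shadings to 39, and permutations of
  length at most 5 tell these apart.
*)

theory Submission
  imports Defs
begin

section \<open>Mesh patterns 21 and inversions\<close>

definition no_231 :: "nat list \<Rightarrow> bool" where
  "no_231 p \<longleftrightarrow> (\<forall>c<length p. \<forall>b<c. \<forall>a<b. \<not> (p ! c < p ! a \<and> p ! a < p ! b))"

text \<open>The box containing the point at position \<open>k\<close>, relative to the inversion at positions
  \<open>i < j\<close>; positions are 0-based.\<close>

definition cell :: "nat list \<Rightarrow> nat \<Rightarrow> nat \<Rightarrow> nat \<Rightarrow> nat \<times> nat" where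
  "cell p i j k =
     (if k < i then 0 else if k < j then 1 else 2,
      if p ! k < p ! j then 0 else if p ! k < p ! i then 1 else 2)"

definition has_mesh_inversion :: "nat list \<Rightarrow> (nat \<times> nat) set \<Rightarrow> bool" where
  "has_mesh_inversion p R \<longleftrightarrow>
     (\<exists>j<length p. \<exists>i<j. p ! j < p ! i \<and>
        (\<forall>k<length p. k = i \<or> k = j \<or> cell p i j k \<notin> R))"

lemma has_mesh_inversionI:
  assumes "i < j" "j < length p" "p ! j < p ! i"
    and "\<And>k. k < length p \<Longrightarrow> k \<noteq> i \<Longrightarrow> k \<noteq> j \<Longrightarrow> cell p i j k \<notin> R"
  shows "has_mesh_inversion p R"
  using assms unfolding has_mesh_inversion_def by blast

lemma has_mesh_inversion_mono:
  "has_mesh_inversion p S \<Longrightarrow> R \<subseteq> S \<Longrightarrow> has_mesh_inversion p R"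
  unfolding has_mesh_inversion_def by blast

section \<open>Occurrences of 21 and 231 as conditions on list positions\<close>

lemma perms_distinct: "\<pi> \<in> perms \<Longrightarrow> distinct \<pi>"
  by (simp add: perms_def permutations_of_set_def)

lemma nth_perm_range: "\<pi> \<in> perms \<Longrightarrow> k < length \<pi> \<Longrightarrow> \<pi> ! k \<in> {1..length \<pi>}"
  using nth_mem by (fastforce simp: perms_def permutations_of_set_def)

lemma nth_perm_neq:
  "\<pi> \<in> perms \<Longrightarrow> k < length \<pi> \<Longrightarrow> l < length \<pi> \<Longrightarrow> k \<noteq> l \<Longrightarrow> \<pi> ! k \<noteq> \<pi> ! l"
  by (simp add: nth_eq_iff_index_eq perms_distinct)

lemma length_21: "length [2, 1 :: nat] = 2"
  by simp

lemma length_231: "length [2, 3, 1 :: nat] = 3"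
  by simp

lemma plot_21: "plot [2, 1] = {(1, 2), (2, 1)}"
proof -
  have *: "{1..length [2, 1 :: nat]} = {1, 2}" by auto
  show ?thesis unfolding plot_def * by auto
qed

lemma plot_231: "plot [2, 3, 1] = {(1, 2), (2, 3), (3, 1)}"
proof -
  have *: "{1..length [2, 3, 1 :: nat]} = {1, 2, 3}" by auto
  show ?thesis unfolding plot_def * by auto
qed

text \<open>An occurrence is determined by the positions of its two points: \<open>\<alpha>\<close>
  lists the positions and \<open>\<beta>\<close> the two values in increasing order.
  \<open>mesh_box\<close> counts positions from 1, \<open>cell\<close> from 0, which accounts for
  the shifts by one.\<close>

lemma occurrence_21_iff:
  assumes "\<pi> \<in> perms" "R \<subseteq> {0..2} \<times> {0..2}"
  shows "(\<exists>\<omega>. occurrence ([2, 1], R) \<pi> \<omega>) \<longleftrightarrow> has_mesh_inversion \<pi> R"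
proof
  assume "\<exists>\<omega>. occurrence ([2, 1], R) \<pi> \<omega>"
  then obtain \<alpha> \<beta> where emb: "extended_embedding 2 (length \<pi>) \<alpha>" "extended_embedding 2 (length \<pi>) \<beta>"
    and sub: "{(\<alpha> i, \<beta> j) |i j. (i, j) \<in> plot [2, 1]} \<subseteq> plot \<pi>"
    and box: "\<forall>(i, j)\<in>R. mesh_box \<alpha> \<beta> i j \<inter> plot \<pi> = {}"
    unfolding occurrence_def prod.case length_21 by auto
  have \<alpha>: "\<alpha> 0 = 0" "1 \<le> \<alpha> 1" "\<alpha> 1 < \<alpha> 2" "\<alpha> 2 \<le> length \<pi>" "\<alpha> 3 = length \<pi> + 1"
    using emb(1) by (auto simp: extended_embedding_def strict_mono_on_def image_subset_iff)
  have \<beta>: "\<beta> 0 = 0" "1 \<le> \<beta> 1" "\<beta> 1 < \<beta> 2" "\<beta> 2 \<le> length \<pi>" "\<beta> 3 = length \<pi> + 1"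
    using emb(2) by (auto simp: extended_embedding_def strict_mono_on_def image_subset_iff)
  have "(\<alpha> 1, \<beta> 2) \<in> plot \<pi>" "(\<alpha> 2, \<beta> 1) \<in> plot \<pi>"
    using sub unfolding plot_21 by auto
  then have val: "\<pi> ! (\<alpha> 1 - 1) = \<beta> 2" "\<pi> ! (\<alpha> 2 - 1) = \<beta> 1"
    by (auto simp: plot_def)
  show "has_mesh_inversion \<pi> R"
  proof (rule has_mesh_inversionI[of "\<alpha> 1 - 1" "\<alpha> 2 - 1"])
    fix k assume k: "k < length \<pi>" "k \<noteq> \<alpha> 1 - 1" "k \<noteq> \<alpha> 2 - 1"
    obtain c r where cr: "cell \<pi> (\<alpha> 1 - 1) (\<alpha> 2 - 1) k = (c, r)" by fastforce
    have neq: "\<pi> ! k \<noteq> \<beta> 1" "\<pi> ! k \<noteq> \<beta> 2"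
      using k \<alpha> val nth_perm_neq[OF assms(1), of k "\<alpha> 1 - 1"] nth_perm_neq[OF assms(1), of k "\<alpha> 2 - 1"] by auto
    have rng: "1 \<le> \<pi> ! k" "\<pi> ! k \<le> length \<pi>"
      using nth_perm_range[OF assms(1) k(1)] by auto
    have "(k + 1, \<pi> ! k) \<in> plot \<pi>" using k by (force simp: plot_def)
    \<comment> \<open>The sentinels \<open>\<alpha> 0 = 0\<close> and
      \<open>\<alpha> 3 = length \<pi> + 1\<close> make the outer columns instances of the same
      formula; the rows below work likewise.\<close>
    moreover have "k + 1 \<in> {\<alpha> c + 1..\<alpha> (c + 1) - 1}"
      using cr k \<alpha> by (auto simp: cell_def numeral_3_eq_3 numeral_2_eq_2 split: if_splits)
    moreover have "\<pi> ! k \<in> {\<beta> r + 1..\<beta> (r + 1) - 1}"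
      using cr neq rng val \<beta> by (auto simp: cell_def numeral_3_eq_3 numeral_2_eq_2 split: if_splits)
    ultimately have "mesh_box \<alpha> \<beta> c r \<inter> plot \<pi> \<noteq> {}" unfolding mesh_box_def by blast
    then show "cell \<pi> (\<alpha> 1 - 1) (\<alpha> 2 - 1) k \<notin> R" using box cr by auto
  qed (use \<alpha> \<beta> val in auto)
next
  assume "has_mesh_inversion \<pi> R"
  then obtain i j where ij: "i < j" "j < length \<pi>" "\<pi> ! j < \<pi> ! i"
    and free: "\<And>k. k < length \<pi> \<Longrightarrow> k \<noteq> i \<Longrightarrow> k \<noteq> j \<Longrightarrow> cell \<pi> i j k \<notin> R"
    unfolding has_mesh_inversion_def by blast
  \<comment> \<open>The embeddings are lookups in lists whose first and last entries are the
    sentinels. In \<open>\<beta>\<close> the value at \<open>j\<close> comes first, being the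
    smaller one.\<close>
  define \<alpha> where "\<alpha> = (!) [0, i + 1, j + 1, length \<pi> + 1]"
  define \<beta> where "\<beta> = (!) [0, \<pi> ! j, \<pi> ! i, length \<pi> + 1]"
  have rng: "1 \<le> \<pi> ! i" "\<pi> ! i \<le> length \<pi>" "1 \<le> \<pi> ! j" "\<pi> ! j \<le> length \<pi>"
    using nth_perm_range[OF assms(1), of i] nth_perm_range[OF assms(1), of j] ij by auto
  have "extended_embedding 2 (length \<pi>) \<alpha>" "extended_embedding 2 (length \<pi>) \<beta>"
    using ij rng by (auto simp: extended_embedding_def strict_mono_on_def \<alpha>_def \<beta>_def
        numeral_2_eq_2 le_Suc_eq nth_Cons split: nat.splits)
  moreover have "{(\<alpha> u, \<beta> v) |u v. (u, v) \<in> plot [2, 1]} \<subseteq> plot \<pi>"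
  proof -
    have "(i + 1, \<pi> ! i) \<in> plot \<pi>" "(j + 1, \<pi> ! j) \<in> plot \<pi>"
      using ij by (force simp: plot_def)+
    then show ?thesis
      unfolding plot_21 by (auto simp: \<alpha>_def \<beta>_def numeral_2_eq_2)
  qed
  moreover have "mesh_box \<alpha> \<beta> c r \<inter> plot \<pi> = {}" if cr: "(c, r) \<in> R" for c r
  proof (rule ccontr)
    assume "mesh_box \<alpha> \<beta> c r \<inter> plot \<pi> \<noteq> {}"
    then obtain k where k: "k < length \<pi>" "k + 1 \<in> {\<alpha> c + 1..\<alpha> (c + 1) - 1}"
      "\<pi> ! k \<in> {\<beta> r + 1..\<beta> (r + 1) - 1}"
      by (force simp: mesh_box_def plot_def)
    have "c \<in> {0, 1, 2}" "r \<in> {0, 1, 2}" using cr assms(2) by auto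
    then have "cell \<pi> i j k = (c, r)" "k \<noteq> i" "k \<noteq> j"
      using k ij by (auto simp: cell_def \<alpha>_def \<beta>_def numeral_2_eq_2)
    with free[of k] k cr show False by auto
  qed
  ultimately show "\<exists>\<omega>. occurrence ([2, 1], R) \<pi> \<omega>"
    unfolding occurrence_def prod.case length_21
    by - (rule exI[of _ "{(\<alpha> u, \<beta> v) |u v. (u, v) \<in> plot [2, 1]}"], rule conjI, assumption,
        rule exI[of _ \<alpha>], rule exI[of _ \<beta>], blast)
qed

lemma occurrence_231_iff:
  assumes "\<pi> \<in> perms"
  shows "(\<exists>\<omega>. occurrence (classical [2, 3, 1]) \<pi> \<omega>) \<longleftrightarrow> \<not> no_231 \<pi>"
proof
  assume "\<exists>\<omega>. occurrence (classical [2, 3, 1]) \<pi> \<omega>"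
  then obtain \<alpha> \<beta> where emb: "extended_embedding 3 (length \<pi>) \<alpha>" "extended_embedding 3 (length \<pi>) \<beta>"
    and sub: "{(\<alpha> i, \<beta> j) |i j. (i, j) \<in> plot [2, 3, 1]} \<subseteq> plot \<pi>"
    unfolding occurrence_def classical_def prod.case length_231 by auto
  have \<alpha>: "1 \<le> \<alpha> 1" "\<alpha> 1 < \<alpha> 2" "\<alpha> 2 < \<alpha> 3" "\<alpha> 3 \<le> length \<pi>"
    using emb(1) by (auto simp: extended_embedding_def strict_mono_on_def image_subset_iff)
  have \<beta>: "\<beta> 1 < \<beta> 2" "\<beta> 2 < \<beta> 3"
    using emb(2) by (auto simp: extended_embedding_def strict_mono_on_def image_subset_iff)
  have "(\<alpha> 1, \<beta> 2) \<in> plot \<pi>" "(\<alpha> 2, \<beta> 3) \<in> plot \<pi>" "(\<alpha> 3, \<beta> 1) \<in> plot \<pi>"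
    using sub unfolding plot_231 by auto
  then have "\<pi> ! (\<alpha> 1 - 1) = \<beta> 2" "\<pi> ! (\<alpha> 2 - 1) = \<beta> 3" "\<pi> ! (\<alpha> 3 - 1) = \<beta> 1"
    by (auto simp: plot_def)
  moreover have "\<alpha> 3 - 1 < length \<pi>" "\<alpha> 2 - 1 < \<alpha> 3 - 1" "\<alpha> 1 - 1 < \<alpha> 2 - 1"
    using \<alpha> by auto
  ultimately show "\<not> no_231 \<pi>" using \<beta> unfolding no_231_def by metis
next
  assume "\<not> no_231 \<pi>"
  then obtain a b c where abc: "c < length \<pi>" "b < c" "a < b" "\<pi> ! c < \<pi> ! a" "\<pi> ! a < \<pi> ! b"
    unfolding no_231_def by blast
  define \<alpha> where "\<alpha> = (!) [0, a + 1, b + 1, c + 1, length \<pi> + 1]"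
  \<comment> \<open>The values appear in increasing order: in a 231 at \<open>a < b < c\<close> the
    last value is the least and the middle one the greatest.\<close>
  define \<beta> where "\<beta> = (!) [0, \<pi> ! c, \<pi> ! a, \<pi> ! b, length \<pi> + 1]"
  have "extended_embedding 3 (length \<pi>) \<alpha>" "extended_embedding 3 (length \<pi>) \<beta>"
    using abc nth_perm_range[OF assms, of a] nth_perm_range[OF assms, of b] nth_perm_range[OF assms, of c]
    by (auto simp: extended_embedding_def strict_mono_on_def \<alpha>_def \<beta>_def
        numeral_3_eq_3 le_Suc_eq nth_Cons split: nat.splits)
  moreover have "{(\<alpha> u, \<beta> v) |u v. (u, v) \<in> plot [2, 3, 1]} \<subseteq> plot \<pi>"
  proof -
    have "(a + 1, \<pi> ! a) \<in> plot \<pi>" "(b + 1, \<pi> ! b) \<in> plot \<pi>" "(c + 1, \<pi> ! c) \<in> plot \<pi>"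
      using abc by (force simp: plot_def)+
    then show ?thesis
      unfolding plot_231 by (auto simp: \<alpha>_def \<beta>_def numeral_3_eq_3 numeral_2_eq_2)
  qed
  ultimately show "\<exists>\<omega>. occurrence (classical [2, 3, 1]) \<pi> \<omega>"
    unfolding occurrence_def classical_def prod.case length_231 by auto
qed

section \<open>Shading boxes without changing containment\<close>

context
  fixes p :: "nat list" and R :: "(nat \<times> nat) set"
  assumes p: "distinct p" "no_231 p"
    and R: "has_mesh_inversion p R"
begin

lemma no231: "a < b \<Longrightarrow> b < c \<Longrightarrow> c < length p \<Longrightarrow> p ! c < p ! a \<Longrightarrow> p ! a < p ! b \<Longrightarrow> False"
  using p(2) unfolding no_231_def by blast

lemma nth_neq: "a < length p \<Longrightarrow> b < length p \<Longrightarrow> a \<noteq> b \<Longrightarrow> p ! a \<noteq> p ! b"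
  using p(1) by (simp add: nth_eq_iff_index_eq)

text \<open>Common frame of the insertion lemmas. If box \<open>c\<close> is empty for the given
  inversion, nothing has to be done; otherwise a point \<open>x\<close> of \<open>c\<close>
  maximizing \<open>f\<close> exists by finiteness. Integer values allow a lowest point to be chosen
  by negation.\<close>

lemma insert_cell:
  fixes f :: "nat \<Rightarrow> int"
  assumes step: "\<And>i j x. \<lbrakk>i < j; j < length p; p ! j < p ! i;
      \<And>k. k < length p \<Longrightarrow> k \<noteq> i \<Longrightarrow> k \<noteq> j \<Longrightarrow> cell p i j k \<notin> R;
      x < length p; x \<noteq> i; x \<noteq> j; cell p i j x = c;
      \<And>k. k < length p \<Longrightarrow> k \<noteq> i \<Longrightarrow> k \<noteq> j \<Longrightarrow> cell p i j k = c \<Longrightarrow> f k \<le> f x\<rbrakk>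
      \<Longrightarrow> has_mesh_inversion p (insert c R)"
  shows "has_mesh_inversion p (insert c R)"
proof -
  obtain i j where ij: "i < j" "j < length p" "p ! j < p ! i"
    and free: "\<And>k. k < length p \<Longrightarrow> k \<noteq> i \<Longrightarrow> k \<noteq> j \<Longrightarrow> cell p i j k \<notin> R"
    using R unfolding has_mesh_inversion_def by blast
  define X where "X = {k. k < length p \<and> k \<noteq> i \<and> k \<noteq> j \<and> cell p i j k = c}"
  show ?thesis
  proof (cases "X = {}")
    case True
    with ij free show ?thesis by (intro has_mesh_inversionI[of i j]) (auto simp: X_def)
  next
    case False
    have "finite X" by (simp add: X_def)
    with False obtain x where "x \<in> X" "\<And>k. k \<in> X \<Longrightarrow> f k \<le> f x"
      using Max_in[of "f ` X"] Max_ge[of "f ` X"]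
      by (metis (no_types, lifting) finite_imageI image_iff image_is_empty)
    with ij free show ?thesis by (intro step[of i j x]) (auto simp: X_def)
  qed
qed

lemma insert_01: "has_mesh_inversion p (insert (0, 1) R)"
proof (rule insert_cell[where f = int])
  fix i j x
  assume "i < j" "j < length p" "p ! j < p ! i" "x < length p" "x \<noteq> j" "cell p i j x = (0, 1)"
  then show "has_mesh_inversion p (insert (0, 1) R)"
    \<comment> \<open>The points at \<open>x\<close>, \<open>i\<close>, \<open>j\<close> would form
      a 231, so the box is empty.\<close>
    using no231[of x i j] nth_neq[of x j] by (auto simp: cell_def split: if_splits)
qed

lemma insert_12: "has_mesh_inversion p (insert (1, 2) R)"
proof (rule insert_cell[where f = int])
  fix i j x
  assume "i < j" "j < length p" "p ! j < p ! i" "x < length p" "x \<noteq> i" "cell p i j x = (1, 2)"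
  then show "has_mesh_inversion p (insert (1, 2) R)"
    \<comment> \<open>Here \<open>i\<close>, \<open>x\<close>, \<open>j\<close> would form a
      231.\<close>
    using no231[of i x j] nth_neq[of i x] by (auto simp: cell_def split: if_splits)
qed

text \<open>Move the second point from \<open>j\<close> to the highest point \<open>x\<close> of box
  (1, 1). Only box (2, 0) can gain points, among them the old \<open>j\<close>: other transfers
  between boxes would give a 231 or a point of the old box (1, 1) above \<open>x\<close>.\<close>

lemma insert_11_if_20_unshaded:
  assumes "(2, 0) \<notin> R"
  shows "has_mesh_inversion p (insert (1, 1) R)"
proof (rule insert_cell[where f = "\<lambda>k. int (p ! k)"])
  fix i j x
  assume ij: "i < j" "j < length p" "p ! j < p ! i"
    and free: "\<And>k. k < length p \<Longrightarrow> k \<noteq> i \<Longrightarrow> k \<noteq> j \<Longrightarrow> cell p i j k \<notin> R"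
    and x: "x < length p" "x \<noteq> i" "x \<noteq> j" "cell p i j x = (1, 1)"
    and extremal: "\<And>k. k < length p \<Longrightarrow> k \<noteq> i \<Longrightarrow> k \<noteq> j \<Longrightarrow> cell p i j k = (1, 1) \<Longrightarrow>
      int (p ! k) \<le> int (p ! x)"
  note neq = nth_neq[of x i] nth_neq[of x j]
  have x': "i < x" "x < j" "p ! j < p ! x" "p ! x < p ! i"
    using x ij neq by (auto simp: cell_def split: if_splits)
  show "has_mesh_inversion p (insert (1, 1) R)"
  proof (rule has_mesh_inversionI[of i x])
    fix k assume k: "k < length p" "k \<noteq> i" "k \<noteq> x"
    show "cell p i x k \<notin> insert (1, 1) R"
    proof (cases "k = j")
      case True
      then show ?thesis using assms ij x' by (auto simp: cell_def)
    next
      case False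
      have "p ! k \<noteq> p ! i" "p ! k \<noteq> p ! j" "p ! k \<noteq> p ! x"
        using k False ij x(1) nth_neq by auto
      \<comment> \<open>The old and new lines cut the plane into 4 by 4 regions. For
        \<open>k\<close> in each of them, its new box is known to be unshaded, or its old box is
        free of points when that box is shaded, or \<open>k\<close> contradicts extremality of
        \<open>x\<close>, or it completes a 231. The later insertion lemmas argue in the same
        way.\<close>
      then have "k < i \<or> i < k \<and> k < x \<or> x < k \<and> k < j \<or> j < k"
        "p ! k < p ! j \<or> p ! j < p ! k \<and> p ! k < p ! x \<or> p ! x < p ! k \<and> p ! k < p ! i \<or> p ! i < p ! k"
        using k False by linarith+
      moreover have "cell p i j k \<notin> R" "cell p i j k = (1, 1) \<Longrightarrow> int (p ! k) \<le> int (p ! x)"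
        using free[of k] extremal[of k] k False by auto
      ultimately show ?thesis
        using no231[of i k j] no231[of k x j] assms k(1) ij x(1) x'
        unfolding cell_def
        by (elim disjE conjE) simp_all
    qed
  qed (use ij x(1) x' in auto)
qed

text \<open>Move the first point from \<open>i\<close> to the lowest point of box (1, 1). The old
  \<open>i\<close> falls into (0, 2); points of the old (1, 0) may enter (0, 0), and points of the
  old (2, 1) may enter (2, 2). The two implications say that a shaded receiving box has a shaded,
  hence empty, source.\<close>

lemma insert_11_if_02_unshaded:
  assumes "(0, 2) \<notin> R" "(1, 0) \<notin> R \<Longrightarrow> (0, 0) \<notin> R" "(2, 1) \<notin> R \<Longrightarrow> (2, 2) \<notin> R"
  shows "has_mesh_inversion p (insert (1, 1) R)"
proof (rule insert_cell[where f = "\<lambda>k. - int (p ! k)"])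
  fix i j x
  assume ij: "i < j" "j < length p" "p ! j < p ! i"
    and free: "\<And>k. k < length p \<Longrightarrow> k \<noteq> i \<Longrightarrow> k \<noteq> j \<Longrightarrow> cell p i j k \<notin> R"
    and x: "x < length p" "x \<noteq> i" "x \<noteq> j" "cell p i j x = (1, 1)"
    and extremal: "\<And>k. k < length p \<Longrightarrow> k \<noteq> i \<Longrightarrow> k \<noteq> j \<Longrightarrow> cell p i j k = (1, 1) \<Longrightarrow>
      - int (p ! k) \<le> - int (p ! x)"
  note neq = nth_neq[of x i] nth_neq[of x j]
  have x': "i < x" "x < j" "p ! j < p ! x" "p ! x < p ! i"
    using x ij neq by (auto simp: cell_def split: if_splits)
  show "has_mesh_inversion p (insert (1, 1) R)"
  proof (rule has_mesh_inversionI[of x j])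
    fix k assume k: "k < length p" "k \<noteq> x" "k \<noteq> j"
    show "cell p x j k \<notin> insert (1, 1) R"
    proof (cases "k = i")
      case True
      then show ?thesis using assms ij x' by (auto simp: cell_def)
    next
      case False
      have "p ! k \<noteq> p ! i" "p ! k \<noteq> p ! j" "p ! k \<noteq> p ! x"
        using k False ij x(1) nth_neq by auto
      then have "k < i \<or> i < k \<and> k < x \<or> x < k \<and> k < j \<or> j < k"
        "p ! k < p ! j \<or> p ! j < p ! k \<and> p ! k < p ! x \<or> p ! x < p ! k \<and> p ! k < p ! i \<or> p ! i < p ! k"
        using k False by linarith+
      moreover have "cell p i j k \<notin> R" "cell p i j k = (1, 1) \<Longrightarrow> - int (p ! k) \<le> - int (p ! x)"
        using free[of k] extremal[of k] k False by auto
      ultimately show ?thesis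
        using no231[of x k j] assms k(1) ij x(1) x'
        unfolding cell_def
        by (elim disjE conjE) simp_all
    qed
  qed (use ij x(1) x' in auto)
qed

text \<open>Move the first point from \<open>i\<close> to the highest point of box (0, 2). The old
  \<open>i\<close> falls into (1, 1), and the transfers of the previous lemma run backwards: from
  (0, 0) to (1, 0) and from (2, 2) to (2, 1).\<close>

lemma insert_02:
  assumes "(1, 1) \<notin> R" "(0, 0) \<notin> R \<Longrightarrow> (1, 0) \<notin> R" "(2, 2) \<notin> R \<Longrightarrow> (2, 1) \<notin> R"
  shows "has_mesh_inversion p (insert (0, 2) R)"
proof (rule insert_cell[where f = "\<lambda>k. int (p ! k)"])
  fix i j x
  assume ij: "i < j" "j < length p" "p ! j < p ! i"
    and free: "\<And>k. k < length p \<Longrightarrow> k \<noteq> i \<Longrightarrow> k \<noteq> j \<Longrightarrow> cell p i j k \<notin> R"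
    and x: "x < length p" "x \<noteq> i" "x \<noteq> j" "cell p i j x = (0, 2)"
    and extremal: "\<And>k. k < length p \<Longrightarrow> k \<noteq> i \<Longrightarrow> k \<noteq> j \<Longrightarrow> cell p i j k = (0, 2) \<Longrightarrow>
      int (p ! k) \<le> int (p ! x)"
  note neq = nth_neq[of x i] nth_neq[of x j]
  have x': "x < i" "p ! i < p ! x"
    using x ij neq by (auto simp: cell_def split: if_splits)
  show "has_mesh_inversion p (insert (0, 2) R)"
  proof (rule has_mesh_inversionI[of x j])
    fix k assume k: "k < length p" "k \<noteq> x" "k \<noteq> j"
    show "cell p x j k \<notin> insert (0, 2) R"
    proof (cases "k = i")
      case True
      then show ?thesis using assms ij x' by (auto simp: cell_def)
    next
      case False
      have "p ! k \<noteq> p ! i" "p ! k \<noteq> p ! j" "p ! k \<noteq> p ! x"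
        using k False ij x(1) nth_neq by auto
      then have "k < x \<or> x < k \<and> k < i \<or> i < k \<and> k < j \<or> j < k"
        "p ! k < p ! j \<or> p ! j < p ! k \<and> p ! k < p ! i \<or> p ! i < p ! k \<and> p ! k < p ! x \<or> p ! x < p ! k"
        using k False by linarith+
      moreover have "cell p i j k \<notin> R" "cell p i j k = (0, 2) \<Longrightarrow> int (p ! k) \<le> int (p ! x)"
        using free[of k] extremal[of k] k False by auto
      ultimately show ?thesis
        using no231[of k x i] assms k(1) ij x(1) x'
        unfolding cell_def
        by (elim disjE conjE) simp_all
    qed
  qed (use ij x(1) x' in auto)
qed

text \<open>Move the second point from \<open>j\<close> to the lowest point of box (1, 0). The old
  \<open>j\<close> falls into (2, 1), and points of the old (1, 0) to the left of the new point fall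
  into (1, 1); these are the two boxes assumed unshaded.\<close>

lemma insert_10:
  assumes "(1, 1) \<notin> R" "(2, 1) \<notin> R"
  shows "has_mesh_inversion p (insert (1, 0) R)"
proof (rule insert_cell[where f = "\<lambda>k. - int (p ! k)"])
  fix i j x
  assume ij: "i < j" "j < length p" "p ! j < p ! i"
    and free: "\<And>k. k < length p \<Longrightarrow> k \<noteq> i \<Longrightarrow> k \<noteq> j \<Longrightarrow> cell p i j k \<notin> R"
    and x: "x < length p" "x \<noteq> i" "x \<noteq> j" "cell p i j x = (1, 0)"
    and extremal: "\<And>k. k < length p \<Longrightarrow> k \<noteq> i \<Longrightarrow> k \<noteq> j \<Longrightarrow> cell p i j k = (1, 0) \<Longrightarrow>
      - int (p ! k) \<le> - int (p ! x)"
  note neq = nth_neq[of x i] nth_neq[of x j]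
  have x': "i < x" "x < j" "p ! x < p ! j"
    using x ij neq by (auto simp: cell_def split: if_splits)
  show "has_mesh_inversion p (insert (1, 0) R)"
  proof (rule has_mesh_inversionI[of i x])
    fix k assume k: "k < length p" "k \<noteq> i" "k \<noteq> x"
    show "cell p i x k \<notin> insert (1, 0) R"
    proof (cases "k = j")
      case True
      then show ?thesis using assms ij x' by (auto simp: cell_def)
    next
      case False
      have "p ! k \<noteq> p ! i" "p ! k \<noteq> p ! j" "p ! k \<noteq> p ! x"
        using k False ij x(1) nth_neq by auto
      then have "k < i \<or> i < k \<and> k < x \<or> x < k \<and> k < j \<or> j < k"
        "p ! k < p ! x \<or> p ! x < p ! k \<and> p ! k < p ! j \<or> p ! j < p ! k \<and> p ! k < p ! i \<or> p ! i < p ! k"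
        using k False by linarith+
      moreover have "cell p i j k \<notin> R" "cell p i j k = (1, 0) \<Longrightarrow> - int (p ! k) \<le> - int (p ! x)"
        using free[of k] extremal[of k] k False by auto
      ultimately show ?thesis
        using no231[of i k j] no231[of k i x] assms k(1) ij x(1) x'
        unfolding cell_def
        by (elim disjE conjE) simp_all
    qed
  qed (use ij x(1) x' in auto)
qed

text \<open>Move the second point from \<open>j\<close> to the lowest point of box (2, 0). The old
  \<open>j\<close> now falls into (1, 1), while the other points of the old (2, 0) end up in (1, 1)
  or (2, 1).\<close>

lemma insert_20:
  assumes "(1, 1) \<notin> R" "(2, 1) \<notin> R"
  shows "has_mesh_inversion p (insert (2, 0) R)"
proof (rule insert_cell[where f = "\<lambda>k. - int (p ! k)"])
  fix i j x
  assume ij: "i < j" "j < length p" "p ! j < p ! i"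
    and free: "\<And>k. k < length p \<Longrightarrow> k \<noteq> i \<Longrightarrow> k \<noteq> j \<Longrightarrow> cell p i j k \<notin> R"
    and x: "x < length p" "x \<noteq> i" "x \<noteq> j" "cell p i j x = (2, 0)"
    and extremal: "\<And>k. k < length p \<Longrightarrow> k \<noteq> i \<Longrightarrow> k \<noteq> j \<Longrightarrow> cell p i j k = (2, 0) \<Longrightarrow>
      - int (p ! k) \<le> - int (p ! x)"
  note neq = nth_neq[of x i] nth_neq[of x j]
  have x': "j < x" "p ! x < p ! j"
    using x ij neq by (auto simp: cell_def split: if_splits)
  show "has_mesh_inversion p (insert (2, 0) R)"
  proof (rule has_mesh_inversionI[of i x])
    fix k assume k: "k < length p" "k \<noteq> i" "k \<noteq> x"
    show "cell p i x k \<notin> insert (2, 0) R"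
    proof (cases "k = j")
      case True
      then show ?thesis using assms ij x' by (auto simp: cell_def)
    next
      case False
      have "p ! k \<noteq> p ! i" "p ! k \<noteq> p ! j" "p ! k \<noteq> p ! x"
        using k False ij x(1) nth_neq by auto
      then have "k < i \<or> i < k \<and> k < j \<or> j < k \<and> k < x \<or> x < k"
        "p ! k < p ! x \<or> p ! x < p ! k \<and> p ! k < p ! j \<or> p ! j < p ! k \<and> p ! k < p ! i \<or> p ! i < p ! k"
        using k False by linarith+
      moreover have "cell p i j k \<notin> R" "cell p i j k = (2, 0) \<Longrightarrow> - int (p ! k) \<le> - int (p ! x)"
        using free[of k] extremal[of k] k False by auto
      ultimately show ?thesis
        using no231[of i k x] no231[of k i x] assms k(1) ij x(1) x'
        unfolding cell_def
        by (elim disjE conjE) simp_all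
    qed
  qed (use ij x(1) x' in auto)
qed

text \<open>Move the second point from \<open>j\<close> to the rightmost point of box (2, 1); the
  old \<open>j\<close> falls into (1, 0). Taking the rightmost point also keeps points of the old
  (2, 1) from entering (2, 0), so all gains lie in (1, 0) and (1, 1).\<close>

lemma insert_21:
  assumes "(1, 0) \<notin> R" "(1, 1) \<notin> R"
  shows "has_mesh_inversion p (insert (2, 1) R)"
proof (rule insert_cell[where f = "\<lambda>k. int k"])
  fix i j x
  assume ij: "i < j" "j < length p" "p ! j < p ! i"
    and free: "\<And>k. k < length p \<Longrightarrow> k \<noteq> i \<Longrightarrow> k \<noteq> j \<Longrightarrow> cell p i j k \<notin> R"
    and x: "x < length p" "x \<noteq> i" "x \<noteq> j" "cell p i j x = (2, 1)"
    and extremal: "\<And>k. k < length p \<Longrightarrow> k \<noteq> i \<Longrightarrow> k \<noteq> j \<Longrightarrow> cell p i j k = (2, 1) \<Longrightarrow>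
      int k \<le> int x"
  note neq = nth_neq[of x i] nth_neq[of x j]
  have x': "j < x" "p ! j < p ! x" "p ! x < p ! i"
    using x ij neq by (auto simp: cell_def split: if_splits)
  show "has_mesh_inversion p (insert (2, 1) R)"
  proof (rule has_mesh_inversionI[of i x])
    fix k assume k: "k < length p" "k \<noteq> i" "k \<noteq> x"
    show "cell p i x k \<notin> insert (2, 1) R"
    proof (cases "k = j")
      case True
      then show ?thesis using assms ij x' by (auto simp: cell_def)
    next
      case False
      have "p ! k \<noteq> p ! i" "p ! k \<noteq> p ! j" "p ! k \<noteq> p ! x"
        using k False ij x(1) nth_neq by auto
      then have "k < i \<or> i < k \<and> k < j \<or> j < k \<and> k < x \<or> x < k"
        "p ! k < p ! j \<or> p ! j < p ! k \<and> p ! k < p ! x \<or> p ! x < p ! k \<and> p ! k < p ! i \<or> p ! i < p ! k"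
        using k False by linarith+
      moreover have "cell p i j k \<notin> R" "cell p i j k = (2, 1) \<Longrightarrow> int k \<le> int x"
        using free[of k] extremal[of k] k False by auto
      ultimately show ?thesis
        using no231[of i k x] no231[of k i j] assms k(1) ij x(1) x'
        unfolding cell_def
        by (elim disjE conjE) simp_all
    qed
  qed (use ij x(1) x' in auto)
qed

end

section \<open>Normal forms of shadings\<close>

definition coincide :: "(nat \<times> nat) set \<Rightarrow> (nat \<times> nat) set \<Rightarrow> bool" where
  "coincide R S \<longleftrightarrow>
     (\<forall>p\<in>perms. no_231 p \<longrightarrow> (has_mesh_inversion p R \<longleftrightarrow> has_mesh_inversion p S))"

lemma coincide_refl: "coincide R R"
  by (simp add: coincide_def)

lemma coincide_sym: "coincide R S \<Longrightarrow> coincide S R"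
  by (simp add: coincide_def)

lemma coincide_trans: "coincide R S \<Longrightarrow> coincide S T \<Longrightarrow> coincide R T"
  by (simp add: coincide_def)

text \<open>Shading more boxes can only destroy occurrences, so containment for \<open>S\<close> is
  squeezed between containment for \<open>T\<close> and for \<open>R\<close>.\<close>

lemma coincide_between:
  assumes "coincide R T" "R \<subseteq> S" "S \<subseteq> T"
  shows "coincide R S"
  using assms has_mesh_inversion_mono unfolding coincide_def by blast

lemma Av_eq_iff_coincide:
  assumes "R \<subseteq> {0..2} \<times> {0..2}" "S \<subseteq> {0..2} \<times> {0..2}"
  shows "Av {classical [2, 3, 1], ([2, 1], R)} = Av {classical [2, 3, 1], ([2, 1], S)} \<longleftrightarrow> coincide R S"
proof -
  have "Av {classical [2, 3, 1], ([2, 1], T)} = {p \<in> perms. no_231 p \<and> \<not> has_mesh_inversion p T}"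
    if T: "T \<subseteq> {0..2} \<times> {0..2}" for T
  proof -
    have "avoids p ([2, 1], T) \<longleftrightarrow> \<not> has_mesh_inversion p T"
      "avoids p (classical [2, 3, 1]) \<longleftrightarrow> no_231 p" if "p \<in> perms" for p
      using occurrence_21_iff[OF that T] occurrence_231_iff[OF that] unfolding avoids_def by blast+
    then show ?thesis unfolding Av_def by auto
  qed
  with assms show ?thesis unfolding coincide_def by auto
qed

definition unshade :: "nat \<times> nat \<Rightarrow> ((nat \<times> nat) set \<Rightarrow> bool) \<Rightarrow> (nat \<times> nat) set \<Rightarrow> (nat \<times> nat) set" where
  "unshade c P R = (if P R then R - {c} else R)"

text \<open>An insertion lemma read backwards, with \<open>S\<close> equal to
  \<open>R - {c}\<close>. Removing a box from the shading preserves containment by monotonicity, and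
  the assumption supplies the converse.\<close>

lemma coincide_unshade:
  assumes "\<And>p S. \<lbrakk>distinct p; no_231 p; has_mesh_inversion p S; P (insert c S)\<rbrakk>
    \<Longrightarrow> has_mesh_inversion p (insert c S)"
  shows "coincide R (unshade c P R)"
proof (cases "P R \<and> c \<in> R")
  case True
  then have "insert c (R - {c}) = R" by blast
  with True assms[of _ "R - {c}"] has_mesh_inversion_mono[of _ R "R - {c}"] perms_distinct
  show ?thesis unfolding coincide_def unshade_def by auto
next
  case False
  then show ?thesis by (auto simp: unshade_def coincide_refl)
qed

text \<open>Each entry corresponds to one insertion lemma, and no condition mentions the box being
  removed. Box (1, 1) is treated before the rules that require it to be unshaded. The list is
  applied once, from left to right.\<close>

definition unshading_rules :: "((nat \<times> nat) set \<Rightarrow> (nat \<times> nat) set) list" where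
  "unshading_rules =
    [unshade (0, 1) (\<lambda>R. True),
     unshade (1, 2) (\<lambda>R. True),
     unshade (1, 1) (\<lambda>R. (0, 2) \<notin> R \<and> ((1, 0) \<notin> R \<longrightarrow> (0, 0) \<notin> R) \<and> ((2, 1) \<notin> R \<longrightarrow> (2, 2) \<notin> R)),
     unshade (1, 1) (\<lambda>R. (2, 0) \<notin> R),
     unshade (1, 0) (\<lambda>R. (1, 1) \<notin> R \<and> (2, 1) \<notin> R),
     unshade (2, 1) (\<lambda>R. (1, 0) \<notin> R \<and> (1, 1) \<notin> R),
     unshade (2, 0) (\<lambda>R. (1, 1) \<notin> R \<and> (2, 1) \<notin> R),
     unshade (0, 2) (\<lambda>R. (1, 1) \<notin> R \<and> ((0, 0) \<notin> R \<longrightarrow> (1, 0) \<notin> R) \<and> ((2, 2) \<notin> R \<longrightarrow> (2, 1) \<notin> R))]"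

lemma coincide_fold:
  assumes "\<forall>f\<in>set fs. \<forall>R. coincide R (f R)"
  shows "coincide R (fold (\<lambda>f. f) fs R)"
  using assms
proof (induction fs arbitrary: R)
  case Nil
  then show ?case by (simp add: coincide_refl)
next
  case (Cons f fs)
  then have "coincide R (f R)" "coincide (f R) (fold (\<lambda>f. f) fs (f R))"
    using Cons.IH by auto
  then show ?case using coincide_trans by simp
qed

lemma coincide_unshading_rules: "coincide R (fold (\<lambda>f. f) unshading_rules R)"
proof (rule coincide_fold)
  show "\<forall>f\<in>set unshading_rules. \<forall>R. coincide R (f R)"
    unfolding unshading_rules_def list.set ball_simps
    by (intro conjI allI TrueI coincide_unshade insert_01 insert_12 insert_11_if_02_unshaded insert_11_if_20_unshaded
        insert_10 insert_21 insert_20 insert_02) auto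
qed

text \<open>The two exceptional values of \<open>S\<close> are left fixed by the rules although each
  is equivalent to the shading of a single corner; they are replaced by hand.\<close>

definition normal_form :: "(nat \<times> nat) set \<Rightarrow> (nat \<times> nat) set" where
  "normal_form R =
     (let S = fold (\<lambda>f. f) unshading_rules R in
      if S = {(0, 0), (1, 1), (2, 0)} then {(0, 0)}
      else if S = {(1, 1), (2, 0), (2, 2)} then {(2, 2)}
      else S)"

lemma coincide_sandwich:
  "coincide {(0, 0), (1, 1), (2, 0)} {(0, 0)}" "coincide {(1, 1), (2, 0), (2, 2)} {(2, 2)}"
proof -
  \<comment> \<open>The rules do not reduce these shadings, but they do reduce a larger one.\<close>
  have "fold (\<lambda>f. f) unshading_rules {(0, 0), (1, 0), (1, 1), (2, 0)} = {(0, 0)}"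
    by code_simp
  then have "coincide {(0, 0)} {(0, 0), (1, 0), (1, 1), (2, 0)}"
    using coincide_unshading_rules coincide_sym by metis
  then show "coincide {(0, 0), (1, 1), (2, 0)} {(0, 0)}"
    by (rule coincide_sym[OF coincide_between]) auto
  have "fold (\<lambda>f. f) unshading_rules {(1, 1), (2, 0), (2, 1), (2, 2)} = {(2, 2)}"
    by code_simp
  then have "coincide {(2, 2)} {(1, 1), (2, 0), (2, 1), (2, 2)}"
    using coincide_unshading_rules coincide_sym by metis
  then show "coincide {(1, 1), (2, 0), (2, 2)} {(2, 2)}"
    by (rule coincide_sym[OF coincide_between]) auto
qed

lemma coincide_normal_form: "coincide R (normal_form R)"
proof -
  let ?S = "fold (\<lambda>f. f) unshading_rules R"
  have "coincide ?S (normal_form R)"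
    using coincide_sandwich coincide_refl by (simp add: normal_form_def Let_def)
  with coincide_unshading_rules show ?thesis by (rule coincide_trans)
qed

section \<open>Counting\<close>

definition boxes :: "(nat \<times> nat) list" where
  "boxes = List.product [0, 1, 2] [0, 1, 2]"

lemma set_boxes: "set boxes = {0..2} \<times> {0..2}"
proof -
  have "{0..2} = set [0, 1, 2 :: nat]" by auto
  then show ?thesis by (simp only: boxes_def set_product)
qed

text \<open>The representatives of the classes. Each list follows the order of \<open>boxes\<close>,
  so that a set of boxes can be looked up by filtering \<open>boxes\<close>.\<close>

definition reduced_shadings :: "(nat \<times> nat) list list" where
  "reduced_shadings =
   [[], [(0, 0)], [(2, 2)], [(1, 0), (2, 1)], [(0, 0), (2, 2)], [(0, 2), (1, 1), (2, 0)],
    [(0, 0), (1, 0), (2, 1)], [(0, 2), (1, 0), (2, 1)], [(1, 0), (2, 0), (2, 1)],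
    [(1, 0), (2, 1), (2, 2)], [(0, 0), (0, 2), (1, 1), (2, 0)], [(0, 2), (1, 0), (1, 1), (2, 0)],
    [(0, 0), (0, 2), (1, 0), (2, 1)], [(0, 0), (1, 0), (2, 0), (2, 1)],
    [(0, 2), (1, 0), (2, 0), (2, 1)], [(0, 0), (1, 1), (2, 0), (2, 1)],
    [(0, 2), (1, 1), (2, 0), (2, 1)], [(0, 0), (1, 1), (2, 0), (2, 2)],
    [(0, 2), (1, 1), (2, 0), (2, 2)], [(1, 0), (1, 1), (2, 0), (2, 2)],
    [(0, 0), (1, 0), (2, 1), (2, 2)], [(0, 2), (1, 0), (2, 1), (2, 2)],
    [(1, 0), (2, 0), (2, 1), (2, 2)], [(0, 0), (0, 2), (1, 0), (1, 1), (2, 0)],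
    [(0, 0), (0, 2), (1, 0), (2, 0), (2, 1)], [(0, 0), (0, 2), (1, 1), (2, 0), (2, 1)],
    [(0, 2), (1, 0), (1, 1), (2, 0), (2, 1)], [(0, 0), (0, 2), (1, 1), (2, 0), (2, 2)],
    [(0, 0), (1, 0), (1, 1), (2, 0), (2, 2)], [(0, 2), (1, 0), (1, 1), (2, 0), (2, 2)],
    [(0, 0), (1, 0), (2, 0), (2, 1), (2, 2)], [(0, 2), (1, 0), (2, 0), (2, 1), (2, 2)],
    [(0, 0), (1, 1), (2, 0), (2, 1), (2, 2)], [(0, 2), (1, 1), (2, 0), (2, 1), (2, 2)],
    [(0, 0), (0, 2), (1, 0), (1, 1), (2, 0), (2, 1)],
    [(0, 0), (0, 2), (1, 0), (1, 1), (2, 0), (2, 2)],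
    [(0, 0), (0, 2), (1, 1), (2, 0), (2, 1), (2, 2)],
    [(0, 2), (1, 0), (1, 1), (2, 0), (2, 1), (2, 2)],
    [(0, 0), (0, 2), (1, 0), (1, 1), (2, 0), (2, 1), (2, 2)]]"

section \<open>Separating the representatives by finitely many 231-avoiders\<close>

definition separating_perms :: "nat list list" where
  "separating_perms = [[1, 3, 2], [2, 1, 3], [3, 1, 2], [3, 2, 1], [4, 1, 3, 2], [4, 2, 1, 3],
     [4, 3, 1, 2], [5, 2, 1, 4, 3]]"

definition signature :: "(nat \<times> nat) set \<Rightarrow> bool list" where
  "signature R = map (\<lambda>p. has_mesh_inversion p R) separating_perms"

lemma signature_cong:
  assumes "coincide R S"
  shows "signature R = signature S"
proof -
  \<comment> \<open>Stated with \<open>set [1..<Suc (length p)]\<close> so that it can be evaluated;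
    the interval required by \<open>perms\<close> is recovered afterwards.\<close>
  have "\<forall>p\<in>set separating_perms. distinct p \<and> set p = set [1..<Suc (length p)]"
    by code_simp
  then have "\<forall>p\<in>set separating_perms. p \<in> perms"
    by (simp add: perms_def permutations_of_set_def atLeastLessThanSuc_atLeastAtMost del: upt_Suc)
  moreover have "\<forall>p\<in>set separating_perms. no_231 p"
    by (simp add: separating_perms_def no_231_def eval_nat_numeral All_less_Suc less_Suc_eq)
  ultimately show ?thesis using assms by (simp add: signature_def coincide_def)
qed

text \<open>One entry per inversion, listing the boxes of all other points. This table does not
  depend on the shading, so a signature becomes a finite test on concrete lists.\<close>

definition inversion_cells :: "nat list \<Rightarrow> (nat \<times> nat) list list" where
  "inversion_cells p =
     concat (map (\<lambda>j. map (\<lambda>i. map (cell p i j) (filter (\<lambda>k. k \<noteq> i \<and> k \<noteq> j) [0..<length p]))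
       (filter (\<lambda>i. p ! j < p ! i) [0..<j])) [0..<length p])"

lemma has_mesh_inversion_inversion_cells:
  "has_mesh_inversion p R \<longleftrightarrow> list_ex (list_all (\<lambda>c. c \<notin> R)) (inversion_cells p)"
proof -
  have "list_ex (list_all (\<lambda>c. c \<notin> R)) (inversion_cells p) \<longleftrightarrow>
    (\<exists>j\<in>{..<length p}. \<exists>i\<in>{i \<in> {..<j}. p ! j < p ! i}.
      \<forall>k\<in>{k \<in> {..<length p}. k \<noteq> i \<and> k \<noteq> j}. cell p i j k \<notin> R)"
    unfolding list_ex_iff list_all_iff inversion_cells_def set_concat set_map set_filter set_upt
      atLeast0LessThan by simp
  then show ?thesis unfolding has_mesh_inversion_def by blast
qed

lemma signature_code:
  "signature R = map (list_ex (list_all (\<lambda>c. c \<notin> R))) (map inversion_cells separating_perms)"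
  by (simp add: signature_def has_mesh_inversion_inversion_cells)

lemma distinct_signatures: "distinct (map (signature \<circ> set) reduced_shadings)"
  unfolding comp_def signature_code by code_simp

text \<open>These predicates are named because \<open>code_simp\<close> unfolds the rules symbolically under a \<open>\<lambda>\<close>
  and the nested conditionals then blow up exponentially.\<close>

definition has_listed_normal_form :: "(nat \<times> nat) list \<Rightarrow> bool" where
  "has_listed_normal_form xs \<longleftrightarrow> normal_form (set xs) \<subseteq> set boxes \<and>
     filter (\<lambda>c. c \<in> normal_form (set xs)) boxes \<in> set reduced_shadings"

definition is_normal :: "(nat \<times> nat) list \<Rightarrow> bool" where
  "is_normal xs \<longleftrightarrow> set xs \<subseteq> set boxes \<and> normal_form (set xs) = set xs"

text \<open>One inclusion evaluates the normal form of all 512 shadings, enumerated by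
  \<open>subseqs\<close>; the other checks that each listed shading is its own normal form.\<close>

lemma normal_form_image: "normal_form ` Pow (set boxes) = set ` set reduced_shadings"
proof
  show "normal_form ` Pow (set boxes) \<subseteq> set ` set reduced_shadings"
  proof
    fix S
    assume "S \<in> normal_form ` Pow (set boxes)"
    then obtain xs where xs: "xs \<in> set (subseqs boxes)" "S = normal_form (set xs)"
      unfolding subseqs_powset[symmetric] by blast
    have "list_all has_listed_normal_form (subseqs boxes)"
      by code_simp
    with xs have "S \<subseteq> set boxes" "filter (\<lambda>c. c \<in> S) boxes \<in> set reduced_shadings"
      unfolding list_all_iff has_listed_normal_form_def by blast+
    moreover from this have "S = set (filter (\<lambda>c. c \<in> S) boxes)" by auto
    ultimately show "S \<in> set ` set reduced_shadings" by blast
  qed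
  have "list_all is_normal reduced_shadings"
    by code_simp
  then show "set ` set reduced_shadings \<subseteq> normal_form ` Pow (set boxes)"
    unfolding list_all_iff is_normal_def by (metis Pow_iff image_eqI image_subsetI)
qed

lemma inj_signature: "inj_on signature (set ` set reduced_shadings)"
  using distinct_signatures by (auto simp: distinct_map inj_on_def)

lemma card_reduced_shadings: "card (set ` set reduced_shadings) = 39"
proof -
  \<comment> \<open>Distinct signatures force distinct underlying sets, so counting the lists counts
    the shadings.\<close>
  have "inj_on set (set reduced_shadings)" "distinct reduced_shadings"
    using distinct_signatures inj_on_imageI2 by (auto simp: distinct_map)
  then have "card (set ` set reduced_shadings) = length reduced_shadings"
    by (simp add: card_image distinct_card)
  then show ?thesis by (simp add: reduced_shadings_def)
qed

text \<open>Normal forms are a complete invariant: coincident shadings have coincident normal forms,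
  these have equal signatures, and signatures are injective on the listed shadings.\<close>

lemma coincide_iff_normal_form:
  assumes "R \<subseteq> set boxes" "S \<subseteq> set boxes"
  shows "coincide R S \<longleftrightarrow> normal_form R = normal_form S"
proof
  assume "coincide R S"
  then have "coincide (normal_form R) (normal_form S)"
    using coincide_normal_form coincide_sym coincide_trans by blast
  moreover have "normal_form R \<in> set ` set reduced_shadings" "normal_form S \<in> set ` set reduced_shadings"
    using assms normal_form_image by blast+
  ultimately show "normal_form R = normal_form S"
    using signature_cong inj_onD[OF inj_signature] by blast
next
  assume "normal_form R = normal_form S"
  then show "coincide R S"
    using coincide_normal_form coincide_sym coincide_trans by metis
qed

section \<open>From normal forms to the number of equivalence classes\<close>

lemma card_quotient_kernel:
  "card (A // {(x, y). x \<in> A \<and> y \<in> A \<and> f x = f y}) = card (f ` A)"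
proof -
  let ?r = "{(x, y). x \<in> A \<and> y \<in> A \<and> f x = f y}"
  have "?r `` {x} = {y \<in> A. f y = f x}" if "x \<in> A" for x
    using that by auto
  \<comment> \<open>The classes are the nonempty fibres of \<open>f\<close>, indexed by its
    values.\<close>
  then have "A // ?r = (\<lambda>z. {y \<in> A. f y = z}) ` f ` A"
    unfolding quotient_def by auto
  moreover have "inj_on (\<lambda>z. {y \<in> A. f y = z}) (f ` A)"
    by (auto simp: inj_on_def)
  ultimately show ?thesis by (simp add: card_image)
qed

lemma mesh_patterns_of_21: "mesh_patterns_of [2, 1] = Pair [2, 1] ` Pow (set boxes)"
proof -
  have "[2, 1] \<in> perms"
    by (auto simp: perms_def permutations_of_set_def)
  then show ?thesis
    unfolding mesh_patterns_of_def mesh_patterns_def set_boxes by (auto simp: numeral_2_eq_2)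
qed

theorem mainTheorem5:
  shows "card (mesh_patterns_of [2, 1]) = 512 \<and>
    equiv (mesh_patterns_of [2, 1]) (coincidence_under [2, 3, 1] (mesh_patterns_of [2, 1])) \<and>
    card (mesh_patterns_of [2, 1] //
          coincidence_under [2, 3, 1] (mesh_patterns_of [2, 1])) = 39"
proof (intro conjI)
  let ?P = "mesh_patterns_of [2, 1]"
  have "card (Pow (set boxes)) = 512"
    unfolding set_boxes by (simp add: card_Pow card_cartesian_product)
  then show "card ?P = 512"
    unfolding mesh_patterns_of_21 by (simp add: card_image inj_on_def)
  show "equiv ?P (coincidence_under [2, 3, 1] ?P)"
    by (auto simp: coincidence_under_def equiv_def refl_on_def sym_def trans_def)
  have "Av {classical [2, 3, 1], p} = Av {classical [2, 3, 1], q} \<longleftrightarrow> normal_form (snd p) = normal_form (snd q)"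
    if p: "p \<in> ?P" and q: "q \<in> ?P" for p q
  proof -
    obtain R where R: "p = ([2, 1], R)" "R \<subseteq> set boxes"
      using p unfolding mesh_patterns_of_21 by blast
    obtain S where S: "q = ([2, 1], S)" "S \<subseteq> set boxes"
      using q unfolding mesh_patterns_of_21 by blast
    show ?thesis
      using R(2) S(2) Av_eq_iff_coincide[of R S] coincide_iff_normal_form[of R S]
      unfolding R(1) S(1) snd_conv set_boxes by metis
  qed
  \<comment> \<open>Coincidence is thus the kernel of the normal form map, and its classes are
    counted by the image of that map.\<close>
  then have "coincidence_under [2, 3, 1] ?P =
    {(p, q). p \<in> ?P \<and> q \<in> ?P \<and> normal_form (snd p) = normal_form (snd q)}"
    unfolding coincidence_under_def by blast
  then have "card (?P // coincidence_under [2, 3, 1] ?P) = card ((\<lambda>p. normal_form (snd p)) ` ?P)"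
    by (simp only: card_quotient_kernel)
  also have "\<dots> = card (normal_form ` Pow (set boxes))"
    unfolding mesh_patterns_of_21 by (simp add: image_image)
  finally show "card (?P // coincidence_under [2, 3, 1] ?P) = 39"
    by (simp add: normal_form_image card_reduced_shadings)
qed

end
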